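(* Let $A=[A_j(x)]_{j=1,\dots,m;\,x\in\mathcal{X}}$ be a matrix with non-negative integer entries whose rational row span contains the constant vector $\mathbf{1}$, and consider the exponential family with canonical statistics $T_j=A_j$. Let $\mathcal{B}$ be the set of non-zero vectors $b\in\mathbb{Z}_{\ge0}^{\mathcal{X}}$ that are orthogonal to $\ker_{\mathbb{Z}}A$, let $b_1,\dots,b_l$ be the unique Hilbert basis of $\mathcal{B}$, and let $B$ be the $l\times n$ matrix ($n=\#\mathcal{X}$) whose rows are $b_1,\dots,b_l$. Then the extended exponential family is fully parametrized by the $B$-model with non-negative parameters: a density $q$ on $(\mathcal{X},\mu)$ belongs to the extended exponential family if and only if there are $\zeta_1,\dots,\zeta_l\ge0$ such that $\prod_{j=1}^l\zeta_j^{b_j(x)}$ is not zero for all $x \in \mathcal{X}$ simultaneously and $$q(x)=\frac{\prod_{j=1}^l\zeta_j^{b_j(x)}}{\sum_{y\in\mathcal{X}}\prod_{j=1}^l\zeta_j^{b_j(y)}\mu(y)},\qquad x\in\mathcal{X}.$$ Moreover, each one of the maximal exposed subsets of the $A$-model is obtained by letting one of the $\zeta_j$'s be zero: for each maximal exposed subset $S\subset\mathcal{X}$ there is $j\in\{1,\dots,l\}$ such that $S=\{x\in\mathcal{X}:b_j(x)=0\}$, i.e. $S$ is the support of the $B$-model densities with $\zeta_j=0$ and $\zeta_i>0$ for $i\ne j$.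
   Context: $\mathcal{X}$ is a finite nonempty set with $n$ points and a reference measure $\mu$ satisfying $\mu(x)>0$ for all $x\in\mathcal{X}$. A density is a function $q:\mathcal{X}\to[0,\infty)$ with $\sum_{x\in\mathcal{X}} q(x)\mu(x)=1$. The exponential family with canonical statistics $T_1,\dots,T_m:\mathcal{X}\to\mathbb{R}$ is the set of densities $p(x;\theta)=\exp\left(\sum_{j=1}^m\theta_jT_j(x)-\psi(\theta)\right)$, $\theta\in\mathbb{R}^m$, where $\psi(\theta)=\log\sum_{x}\exp\left(\sum_j\theta_jT_j(x)\right)\mu(x)$. The extended exponential family is the closure of the exponential family, in the set of all densities, for pointwise convergence on $\mathcal{X}$. For a matrix $C=[C_j(x)]$ with non-negative integer entries, the $C$-model (with non-negative parameters) is the set of densities $p(x;\zeta)\propto\prod_j\zeta_j^{C_j(x)}$, $\zeta_j\ge0$, with the convention $0^0=1$ (equivalently the product is over $j$ with $C_j(x)>0$), for those $\zeta$ for which the monomials are not zero for all $x$. For strictly positive parameters, the $A$-model is the exponential family above ($\zeta_j=e^{\theta_j}$). $\ker_{\mathbb{Z}}A=\{k\in\mathbb{Z}^{\mathcal{X}}:\sum_xA_j(x)k(x)=0,\ j=1,\dots,m\}$, and $b$ is orthogonal to it if $\sum_xb(x)k(x)=0$ for all $k\in\ker_{\mathbb{Z}}A$. The Hilbert basis of $\mathcal{B}$ is the unique inclusion-minimal subset of $\mathcal{B}$ such that every element of $\mathcal{B}$ is a linear combination of its elements with non-negative integer coefficients; it is finite. Let $T=(T_1,\dots,T_m):\mathcal{X}\to\mathbb{R}^m$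 (here $T_j=A_j$) and let $M$ be the convex hull of $T(\mathcal{X})$ (the marginal polytope). A face of $M$ is a subset $F\subset M$ for which there is an affine map $\mathbb{R}^m\to\mathbb{R}$ that is zero on $F$ and strictly positive on $M\setminus F$. A subset $S\subset\mathcal{X}$ is exposed if $S=T^{-1}(F)$ for some face $F$ of $M$. A maximal exposed subset is one that is maximal for inclusion among the nonempty exposed subsets different from $\mathcal{X}$. *)

theory Defs
  imports "HOL-Analysis.Analysis"
begin

text \<open>The sample space is a finite type \<open>'x\<close>; the number of points is \<open>CARD('x)\<close>.\<close>

definition densities :: "('x::finite \<Rightarrow> real) \<Rightarrow> ('x \<Rightarrow> real) set" where
  "densities \<mu> = {q. (\<forall>x. q x \<ge> 0) \<and> (\<Sum>x\<in>UNIV. q x * \<mu> x) = 1}"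

definition log_partition :: "('x::finite \<Rightarrow> real) \<Rightarrow> ('x \<Rightarrow> real^'m) \<Rightarrow> real^'m \<Rightarrow> real" where
  "log_partition \<mu> T \<theta> = ln (\<Sum>x\<in>UNIV. exp (\<Sum>j\<in>UNIV. \<theta> $ j * T x $ j) * \<mu> x)"

definition exp_family :: "('x::finite \<Rightarrow> real) \<Rightarrow> ('x \<Rightarrow> real^'m) \<Rightarrow> ('x \<Rightarrow> real) set" where
  "exp_family \<mu> T =
     range (\<lambda>\<theta> x. exp ((\<Sum>j\<in>UNIV. \<theta> $ j * T x $ j) - log_partition \<mu> T \<theta>))"

text \<open>The topology on functions \<open>'x \<Rightarrow> real\<close> is the product topology, i.e. that of
  pointwise convergence; the closure is taken in the subspace of densities.\<close>

definition extended_exp_family ::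
    "('x::finite \<Rightarrow> real) \<Rightarrow> ('x \<Rightarrow> real^'m) \<Rightarrow> ('x \<Rightarrow> real) set" where
  "extended_exp_family \<mu> T = top_of_set (densities \<mu>) closure_of exp_family \<mu> T"

text \<open>The rows of the model matrix are \<open>C 1, \<dots>, C l\<close>. The power has a natural
  exponent, so \<open>0 ^ 0 = 1\<close> holds as the model requires.\<close>

definition model_monomial :: "nat \<Rightarrow> (nat \<Rightarrow> 'x \<Rightarrow> nat) \<Rightarrow> (nat \<Rightarrow> real) \<Rightarrow> 'x \<Rightarrow> real" where
  "model_monomial l C \<zeta> x = (\<Prod>j\<in>{1..l}. \<zeta> j ^ C j x)"

definition model_density ::
    "('x::finite \<Rightarrow> real) \<Rightarrow> nat \<Rightarrow> (nat \<Rightarrow> 'x \<Rightarrow> nat) \<Rightarrow> (nat \<Rightarrow> real) \<Rightarrow> 'x \<Rightarrow> real" where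
  "model_density \<mu> l C \<zeta> x =
     model_monomial l C \<zeta> x / (\<Sum>y\<in>UNIV. model_monomial l C \<zeta> y * \<mu> y)"

definition int_kernel :: "nat^'x::finite^'m \<Rightarrow> ('x \<Rightarrow> int) set" where
  "int_kernel A = {k. \<forall>j. (\<Sum>x\<in>UNIV. int (A $ j $ x) * k x) = 0}"

definition orthogonal_lattice_vectors :: "nat^'x::finite^'m \<Rightarrow> ('x \<Rightarrow> nat) set" where
  "orthogonal_lattice_vectors A =
     {b. b \<noteq> (\<lambda>x. 0) \<and> (\<forall>k\<in>int_kernel A. (\<Sum>x\<in>UNIV. int (b x) * k x) = 0)}"

definition nat_combinations :: "('x \<Rightarrow> nat) set \<Rightarrow> ('x \<Rightarrow> nat) set" where
  "nat_combinations G =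
     {b. \<exists>F c. finite F \<and> F \<subseteq> G \<and> b = (\<lambda>x. \<Sum>g\<in>F. c g * g x)}"

definition is_hilbert_basis :: "('x \<Rightarrow> nat) set \<Rightarrow> ('x \<Rightarrow> nat) set \<Rightarrow> bool" where
  "is_hilbert_basis \<B> H \<longleftrightarrow>
     H \<subseteq> \<B> \<and> \<B> \<subseteq> nat_combinations H \<and>
     (\<forall>H'. H' \<subseteq> H \<and> \<B> \<subseteq> nat_combinations H' \<longrightarrow> H' = H)"

text \<open>The Hilbert basis of \<open>orthogonal_lattice_vectors A\<close> exists, is unique and is finite:
  it consists of the pointwise minimal vectors.\<close>

lemma incseq_subseq_nat:
  fixes s :: "nat \<Rightarrow> nat"
  shows "\<exists>r. strict_mono r \<and> incseq (\<lambda>n. s (r n))"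
proof -
  obtain g where g: "strict_mono g" "monoseq (\<lambda>n. s (g n))"
    using seq_monosub[of s] by blast
  show ?thesis
  proof (cases "incseq (\<lambda>n. s (g n))")
    case True
    with g show ?thesis by blast
  next
    case False
    with g have dec: "decseq (\<lambda>n. s (g n))" by (simp add: monoseq_iff)
    define v where "v = (LEAST v. \<exists>n. v = s (g n))"
    have "\<exists>n. v = s (g n)" unfolding v_def by (rule LeastI_ex) blast
    then obtain N where N: "v = s (g N)" by blast
    have "v \<le> s (g n)" for n unfolding v_def by (rule Least_le) blast
    moreover have "s (g (N + n)) \<le> s (g N)" for n
      using dec by (simp add: decseq_def)
    ultimately have "s (g (N + n)) = v" for n using N by (metis le_antisym)
    hence "incseq (\<lambda>n. s (g (N + n)))" by (simp add: incseq_def)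
    moreover have "strict_mono (\<lambda>n. g (N + n))" using g(1) by (simp add: strict_mono_def)
    ultimately show ?thesis by blast
  qed
qed

lemma finite_antichain_nat_fun:
  fixes M :: "('x::finite \<Rightarrow> nat) set"
  assumes antichain: "\<And>f g. f \<in> M \<Longrightarrow> g \<in> M \<Longrightarrow> f \<le> g \<Longrightarrow> f = g"
  shows "finite M"
proof (rule ccontr)
  assume "infinite M"
  then obtain f :: "nat \<Rightarrow> 'x \<Rightarrow> nat" where f: "inj f" "range f \<subseteq> M"
    using infinite_countable_subset by blast
  have "\<exists>r. strict_mono r \<and> (\<forall>i\<in>I. incseq (\<lambda>n. f (r n) i))" if "finite I" for I
    using that
  proof (induction I)
    case empty
    have "strict_mono (id :: nat \<Rightarrow> nat)" by (simp add: strict_mono_def)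
    thus ?case by blast
  next
    case (insert i I)
    then obtain r where r: "strict_mono r" "\<And>i'. i' \<in> I \<Longrightarrow> incseq (\<lambda>n. f (r n) i')" by blast
    obtain r' where r': "strict_mono r'" "incseq (\<lambda>n. f (r (r' n)) i)"
      using incseq_subseq_nat[of "\<lambda>n. f (r n) i"] by blast
    have "strict_mono (\<lambda>n. r (r' n))" using r(1) r'(1) by (simp add: strict_mono_def)
    moreover have "incseq (\<lambda>n. f (r (r' n)) i')" if "i' \<in> I" for i'
      using r(2)[OF that] r'(1) by (simp add: incseq_def strict_mono_less_eq)
    ultimately show ?case using r'(2) by blast
  qed
  from this[of UNIV] obtain r where
    r: "strict_mono r" "\<And>i. incseq (\<lambda>n. f (r n) i)" by auto
  have "f (r 0) \<le> f (r 1)" using r(2) by (simp add: le_fun_def incseq_def)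
  with antichain f(2) have "f (r 0) = f (r 1)" by blast
  with f(1) have "r 0 = r 1" by (simp add: inj_eq)
  with r(1) show False by (simp add: strict_mono_eq)
qed

lemma nat_combinations_self: "g \<in> G \<Longrightarrow> g \<in> nat_combinations G"
  unfolding nat_combinations_def
  by (rule CollectI, rule exI[of _ "{g}"], rule exI[of _ "\<lambda>_. 1"]) auto

lemma nat_combinations_add:
  assumes "f \<in> nat_combinations G" "g \<in> nat_combinations G"
  shows "(\<lambda>x. f x + g x) \<in> nat_combinations G"
proof -
  obtain F c where F: "finite F" "F \<subseteq> G" "f = (\<lambda>x. \<Sum>g\<in>F. c g * g x)"
    using assms(1) by (auto simp: nat_combinations_def)
  obtain F' c' where F': "finite F'" "F' \<subseteq> G" "g = (\<lambda>x. \<Sum>g\<in>F'. c' g * g x)"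
    using assms(2) by (auto simp: nat_combinations_def)
  define d where "d h = (if h \<in> F then c h else 0) + (if h \<in> F' then c' h else 0)" for h
  have "f x + g x = (\<Sum>h\<in>F \<union> F'. d h * h x)" for x
  proof -
    have "(\<Sum>h\<in>F. c h * h x) = (\<Sum>h\<in>F \<union> F'. (if h \<in> F then c h else 0) * h x)"
      by (rule sum.mono_neutral_cong_left) (use F F' in auto)
    moreover have "(\<Sum>h\<in>F'. c' h * h x) = (\<Sum>h\<in>F \<union> F'. (if h \<in> F' then c' h else 0) * h x)"
      by (rule sum.mono_neutral_cong_left) (use F F' in auto)
    ultimately show ?thesis
      unfolding F(3) F'(3) d_def by (simp add: sum.distrib add_mult_distrib)
  qed
  with F F' show ?thesis
    unfolding nat_combinations_def
    by (intro CollectI exI[of _ "F \<union> F'"] exI[of _ d]) auto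
qed

lemma orthogonal_lattice_vectors_diff:
  assumes "f \<in> orthogonal_lattice_vectors A" "g \<in> orthogonal_lattice_vectors A"
    and "g \<le> f" "g \<noteq> f"
  shows "(\<lambda>x. f x - g x) \<in> orthogonal_lattice_vectors A"
proof -
  have le: "g x \<le> f x" for x using assms(3) by (simp add: le_fun_def)
  have "(\<lambda>x. f x - g x) \<noteq> (\<lambda>x. 0)"
  proof
    assume "(\<lambda>x. f x - g x) = (\<lambda>x. 0)"
    hence "f x \<le> g x" for x by (metis diff_is_0_eq)
    with le have "g = f" by (intro ext) (metis le_antisym)
    with assms(4) show False by simp
  qed
  thus ?thesis
    using assms(1,2) le
    by (auto simp: orthogonal_lattice_vectors_def of_nat_diff left_diff_distrib sum_subtractf)
qed

lemma hilbert_basis_unique_finite: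
  fixes A :: "nat^'x::finite^'m"
  shows "(\<exists>!H. is_hilbert_basis (orthogonal_lattice_vectors A) H)"
    and "is_hilbert_basis (orthogonal_lattice_vectors A) H \<Longrightarrow> finite H"
proof -
  define \<B> where "\<B> = orthogonal_lattice_vectors A"
  define M where "M = {f \<in> \<B>. \<forall>g\<in>\<B>. g \<le> f \<longrightarrow> g = f}"
  have fin: "finite M"
    by (rule finite_antichain_nat_fun) (auto simp: M_def)
  have least: "M \<subseteq> G" if G: "G \<subseteq> \<B>" "\<B> \<subseteq> nat_combinations G" for G
  proof
    fix f assume f: "f \<in> M"
    hence "f \<in> nat_combinations G" using G(2) by (auto simp: M_def)
    then obtain F c where F: "finite F" "F \<subseteq> G" "f = (\<lambda>x. \<Sum>g\<in>F. c g * g x)"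
      by (auto simp: nat_combinations_def)
    have "f \<noteq> (\<lambda>x. 0)" using f by (auto simp: M_def \<B>_def orthogonal_lattice_vectors_def)
    then obtain h where h: "h \<in> F" "c h \<noteq> 0"
      using F(3) by (metis (no_types, lifting) mult_is_0 sum.neutral)
    have "h x \<le> f x" for x
    proof -
      have "h x \<le> c h * h x" using h(2) by simp
      also have "\<dots> \<le> f x" unfolding F(3) by (rule member_le_sum) (use h F in auto)
      finally show ?thesis .
    qed
    hence "h \<le> f" by (simp add: le_fun_def)
    moreover have "h \<in> \<B>" using h(1) F(2) G(1) by blast
    ultimately have "h = f" using f by (auto simp: M_def)
    with h(1) F(2) show "f \<in> G" by blast
  qed
  have gen: "f \<in> nat_combinations M" if "f \<in> \<B>" for f
    using that
  proof (induction "\<Sum>x\<in>UNIV. f x" arbitrary: f rule: less_induct)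
    case less
    show ?case
    proof (cases "f \<in> M")
      case True
      thus ?thesis by (rule nat_combinations_self)
    next
      case False
      then obtain g where g: "g \<in> \<B>" "g \<le> f" "g \<noteq> f" using less.prems by (auto simp: M_def)
      define d where "d = (\<lambda>x. f x - g x)"
      have d: "d \<in> \<B>"
        using orthogonal_lattice_vectors_diff less.prems g unfolding \<B>_def d_def by blast
      have f_eq: "f = (\<lambda>x. g x + d x)" using g(2) by (auto simp: d_def le_fun_def)
      have pos: "(\<Sum>x\<in>UNIV. h x) > 0" if "h \<in> \<B>" for h
        using that by (auto simp: \<B>_def orthogonal_lattice_vectors_def fun_eq_iff sum_eq_0_iff
            simp flip: neq0_conv)
      have "(\<Sum>x\<in>UNIV. f x) = (\<Sum>x\<in>UNIV. g x) + (\<Sum>x\<in>UNIV. d x)"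
        by (subst f_eq) (simp add: sum.distrib)
      with pos[OF g(1)] pos[OF d] have "g \<in> nat_combinations M" "d \<in> nat_combinations M"
        using less.hyps g(1) d by auto
      from nat_combinations_add[OF this] f_eq show ?thesis by simp
    qed
  qed
  have "is_hilbert_basis \<B> H \<longleftrightarrow> H = M" for H
  proof
    assume "is_hilbert_basis \<B> H"
    moreover from this have "M \<subseteq> H" using least by (auto simp: is_hilbert_basis_def)
    ultimately show "H = M" using gen by (auto simp: is_hilbert_basis_def)
  next
    assume "H = M"
    thus "is_hilbert_basis \<B> H"
      using gen least unfolding is_hilbert_basis_def by (auto simp: M_def)
  qed
  with fin show "\<exists>!H. is_hilbert_basis (orthogonal_lattice_vectors A) H"
    and "is_hilbert_basis (orthogonal_lattice_vectors A) H \<Longrightarrow> finite H"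
    unfolding \<B>_def by auto
qed

definition marginal_polytope :: "('x::finite \<Rightarrow> real^'m) \<Rightarrow> (real^'m) set" where
  "marginal_polytope T = convex hull (range T)"

text \<open>\<open>F = M\<close> and \<open>F = {}\<close> are admitted, via constant affine maps. Unlike
  \<open>exposed_face_of\<close>, this is phrased with an affine map that vanishes exactly on \<open>F\<close>.\<close>

definition marginal_face :: "(real^'m) set \<Rightarrow> (real^'m) set \<Rightarrow> bool" where
  "marginal_face M F \<longleftrightarrow>
     F \<subseteq> M \<and>
     (\<exists>(g :: real^'m \<Rightarrow> real) c. linear g \<and>
        (\<forall>y\<in>F. g y + c = 0) \<and> (\<forall>y\<in>M - F. g y + c > 0))"

definition exposed_subset :: "('x::finite \<Rightarrow> real^'m) \<Rightarrow> 'x set \<Rightarrow> bool" where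
  "exposed_subset T S \<longleftrightarrow> (\<exists>F. marginal_face (marginal_polytope T) F \<and> S = T -` F)"

definition maximal_exposed_subset :: "('x::finite \<Rightarrow> real^'m) \<Rightarrow> 'x set \<Rightarrow> bool" where
  "maximal_exposed_subset T S \<longleftrightarrow>
     exposed_subset T S \<and> S \<noteq> {} \<and> S \<noteq> UNIV \<and>
     (\<forall>S'. exposed_subset T S' \<and> S' \<noteq> {} \<and> S' \<noteq> UNIV \<and> S \<subseteq> S' \<longrightarrow> S' = S)"

definition canonical_statistic :: "nat^'x::finite^'m \<Rightarrow> 'x \<Rightarrow> real^'m" where
  "canonical_statistic A x = (\<chi> j. real (A $ j $ x))"

definition rational_row_span :: "nat^'x::finite^'m::finite \<Rightarrow> (rat^'x) set" where
  "rational_row_span A = vec.span (rows (\<chi> j x. rat_of_nat (A $ j $ x)))"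

end

theory Submission
  imports Defs
begin

text \<open>
  Let \<open>V\<close> be the real row span of \<open>A\<close>. Up to normalization the exponential family consists of the
  functions \<open>exp v\<close> with \<open>v \<in> V\<close>. The Hilbert basis \<open>b 1, \<dots>, b l\<close> spans \<open>V\<close>: each \<open>b j\<close> is orthogonal
  to the integer kernel, hence lies in \<open>V\<close>, and each row of \<open>A\<close>, as well as the constant \<open>1\<close>, is a
  non-negative integer combination of the \<open>b j\<close>. Thus strictly positive parameters \<open>\<zeta> j\<close> give exactly
  the exponential family, and only the boundary needs an argument.
  
  If some \<open>\<zeta> j\<close> vanish, adding \<open>\<epsilon> > 0\<close> to all parameters gives members of the exponential family that
  converge to the given density as \<open>\<epsilon>\<close> tends to 0 (\<open>model_density_in_closure\<close>).
  
  Conversely, let \<open>q\<close> be a limit of the family and \<open>S\<close> its support. The crucial point is that some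
  \<open>f = (\<Sum>j. n j * b j)\<close> has zero set exactly \<open>S\<close>. Otherwise a theorem of the alternative
  (\<open>face_alternative\<close>) yields an integer kernel vector \<open>k\<close> that is non-negative off \<open>S\<close> and positive
  somewhere off \<open>S\<close>. Every member of the exponential family satisfies the binomial equation
  \<open>(\<Prod>x. p x ^ k\<^sup>+ x) = (\<Prod>x. p x ^ k\<^sup>- x)\<close>, which is a closed condition and so passes to \<open>q\<close>; but there
  the left side contains the factor 0 and the right side is positive. Given \<open>f\<close>, put \<open>\<zeta> j = 0\<close>
  whenever \<open>n j > 0\<close>: the monomials then vanish exactly off \<open>S\<close>. On \<open>S\<close> the function \<open>ln q\<close> is a
  combination \<open>(\<Sum>j. c j * b j)\<close>, because this, too, is a closed condition, and \<open>\<zeta> j = exp (c j)\<close> for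
  the remaining \<open>j\<close> reproduces \<open>q\<close> (\<open>closure_imp_model_density\<close>).
  
  The same alternative shows that every exposed subset is the zero set of a non-negative integer
  vector \<open>f = (\<Sum>j. n j * b j)\<close>. It is contained in the zero set of each \<open>b j\<close> with \<open>n j > 0\<close>, which
  is exposed and proper; maximality makes the two equal (\<open>maximal_exposed_subset_basis_zeros\<close>).
  
  The duality needed, both over the rationals (where denominators can be cleared) and over the reals,
  comes from one Farkas lemma for ordered fields.
\<close>

section \<open>Farkas' lemma over an ordered field\<close>

definition dot :: "('j::finite \<Rightarrow> 'a::linordered_field) \<Rightarrow> ('j \<Rightarrow> 'a) \<Rightarrow> 'a" where
  "dot u v = (\<Sum>j\<in>UNIV. u j * v j)"

lemma dot_diff_scale_left: "dot (\<lambda>j. u j - r * w j) v = dot u v - r * dot w v"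
  by (simp add: dot_def sum_subtractf left_diff_distrib sum_distrib_left mult.assoc)

lemma dot_diff_scale_right: "dot u (\<lambda>j. v j - r * w j) = dot u v - r * dot u w"
  by (simp add: dot_def sum_subtractf right_diff_distrib sum_distrib_left mult.left_commute)

text \<open>
  Generators with index in \<open>N\<close> may only be used with non-negative coefficients, the others with any
  coefficient; \<open>N = {}\<close> is duality for linear spans. The proof is by induction on the number of
  generators: a functional \<open>u\<close> that separates \<open>c\<close> from the old generators, but has the wrong sign at the
  new one, defines a projection along the new generator onto the kernel of \<open>u\<close>, and the
  induction hypothesis is applied once more to the projected vectors.
\<close>

lemma farkas:
  fixes a :: "'i \<Rightarrow> 'j::finite \<Rightarrow> 'a::linordered_field" and c :: "'j \<Rightarrow> 'a"
  assumes "finite I"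
  shows "(\<exists>r. (\<forall>i\<in>I \<inter> N. r i \<ge> 0) \<and> (\<forall>j. c j = (\<Sum>i\<in>I. r i * a i j))) \<or>
         (\<exists>u. (\<forall>i\<in>I. dot u (a i) \<ge> 0) \<and> (\<forall>i\<in>I - N. dot u (a i) = 0) \<and> dot u c < 0)"
  using assms
proof (induction I arbitrary: a c)
  case empty
  show ?case
  proof (cases "\<forall>j. c j = 0")
    case False
    then obtain j where "c j \<noteq> 0" by blast
    hence "(\<Sum>j\<in>UNIV. c j * c j) > 0"
      by (intro sum_pos2[of _ j]) (auto simp: zero_less_mult_iff)
    hence "dot (\<lambda>j. - c j) c < 0" by (simp add: dot_def sum_negf)
    thus ?thesis by blast
  qed simp
next
  case (insert i\<^sub>0 I)
  from insert.IH[of c a] show ?case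
  proof (elim disjE exE conjE)
    fix r assume "\<forall>i\<in>I \<inter> N. r i \<ge> 0" "\<forall>j. c j = (\<Sum>i\<in>I. r i * a i j)"
    thus ?thesis using insert.hyps
      by (intro disjI1 exI[of _ "r(i\<^sub>0 := 0)"]) (auto intro!: sum.cong)
  next
    fix u assume u: "\<forall>i\<in>I. dot u (a i) \<ge> 0" "\<forall>i\<in>I - N. dot u (a i) = 0" "dot u c < 0"
    define s where "s = dot u (a i\<^sub>0)"
    show ?thesis
    proof (cases "s = 0 \<or> i\<^sub>0 \<in> N \<and> s > 0")
      case True
      thus ?thesis using u by (intro disjI2 exI[of _ u]) (auto simp: s_def)
    next
      case False
      hence s: "s \<noteq> 0" "i\<^sub>0 \<in> N \<Longrightarrow> s < 0" by auto
      (* a' and c' are the images of a and c under the projection along a i\<^sub>0 onto the kernel of u. *)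
      define a' where "a' i = (\<lambda>j. a i j - dot u (a i) / s * a i\<^sub>0 j)" for i
      define c' where "c' = (\<lambda>j. c j - dot u c / s * a i\<^sub>0 j)"
      from insert.IH[of c' a'] show ?thesis
      proof (elim disjE exE conjE)
        fix r assume r: "\<forall>i\<in>I \<inter> N. r i \<ge> 0" "\<forall>j. c' j = (\<Sum>i\<in>I. r i * a' i j)"
        (* Undoing the projection determines the coefficient of the new generator. *)
        define t where "t = dot u c / s - (\<Sum>i\<in>I. r i * dot u (a i)) / s"
        have "t \<ge> 0" if "i\<^sub>0 \<in> N"
        proof -
          have "(\<Sum>i\<in>I. r i * dot u (a i)) \<ge> 0"
          proof (rule sum_nonneg)
            show "r i * dot u (a i) \<ge> 0" if "i \<in> I" for i
              using that u(1,2) r(1) by (cases "i \<in> N") auto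
          qed
          thus ?thesis using u(3) s(2)[OF that]
            unfolding t_def by (simp add: divide_simps)
        qed
        moreover have "c j = t * a i\<^sub>0 j + (\<Sum>i\<in>I. r i * a i j)" for j
        proof -
          have "(\<Sum>i\<in>I. r i * a' i j)
              = (\<Sum>i\<in>I. r i * a i j) - (\<Sum>i\<in>I. r i * dot u (a i)) / s * a i\<^sub>0 j"
            by (simp add: a'_def right_diff_distrib sum_subtractf sum_distrib_right
                sum_divide_distrib mult.assoc)
          with r(2) have "c' j
              = (\<Sum>i\<in>I. r i * a i j) - (\<Sum>i\<in>I. r i * dot u (a i)) / s * a i\<^sub>0 j" by simp
          thus ?thesis by (simp add: c'_def t_def left_diff_distrib algebra_simps)
        qed
        moreover have "(\<Sum>i\<in>I. (r(i\<^sub>0 := t)) i * a i j) = (\<Sum>i\<in>I. r i * a i j)" for j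
          using insert.hyps by (intro sum.cong) auto
        ultimately show ?thesis using r(1) insert.hyps
          by (intro disjI1 exI[of _ "r(i\<^sub>0 := t)"]) auto
      next
        fix w assume w: "\<forall>i\<in>I. dot w (a' i) \<ge> 0" "\<forall>i\<in>I - N. dot w (a' i) = 0" "dot w c' < 0"
        (* Composing w with the projection makes it vanish at the new generator. *)
        define w' where "w' = (\<lambda>j. w j - dot w (a i\<^sub>0) / s * u j)"
        have "dot w' (a i) = dot w (a' i)" for i
          by (simp only: w'_def a'_def dot_diff_scale_left dot_diff_scale_right) simp
        moreover have "dot w' c = dot w c'"
          by (simp only: w'_def c'_def dot_diff_scale_left dot_diff_scale_right) simp
        moreover have "dot w' (a i\<^sub>0) = 0"
          using s(1) by (simp only: w'_def dot_diff_scale_left flip: s_def) simp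
        ultimately show ?thesis using w by (intro disjI2 exI[of _ w']) auto
      qed
    qed
  qed
qed

section \<open>Vectors orthogonal to the integer kernel\<close>

lemma clear_denominators:
  fixes k :: "'x::finite \<Rightarrow> rat"
  obtains d :: int and n :: "'x \<Rightarrow> int" where "d > 0" "\<And>x. of_int (n x) = of_int d * k x"
proof -
  define e where "e x = snd (quotient_of (k x))" for x
  define d where "d = (\<Prod>x\<in>UNIV. e x)"
  have e: "e x > 0" for x by (simp add: e_def quotient_of_denom_pos')
  have "\<exists>n. of_int n = of_int d * k x" for x
  proof -
    have "k x = of_int (fst (quotient_of (k x))) / of_int (e x)"
      unfolding e_def by (rule quotient_of_div) simp
    moreover have "e x dvd d" unfolding d_def by (rule dvd_prodI) auto
    then obtain f where "d = e x * f" by (elim dvdE)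
    ultimately have "of_int (fst (quotient_of (k x)) * f) = of_int d * k x"
      using e[of x] by (simp add: field_simps)
    thus ?thesis by blast
  qed
  then obtain n where "\<And>x. of_int (n x) = of_int d * k x" by metis
  moreover have "d > 0" unfolding d_def using e by (intro prod_pos) auto
  ultimately show ?thesis by (rule that[rotated])
qed

text \<open>
  Unlike \<open>orthogonal_lattice_vectors\<close>, this admits the zero vector, so that every row of the matrix
  satisfies it.
\<close>

definition kernel_orthogonal :: "nat^'x::finite^'m \<Rightarrow> ('x \<Rightarrow> nat) \<Rightarrow> bool" where
  "kernel_orthogonal A b \<longleftrightarrow> (\<forall>k\<in>int_kernel A. (\<Sum>x\<in>UNIV. int (b x) * k x) = 0)"

text \<open>
  Orthogonality to integer kernel vectors already forces membership in the row span because the matrix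
  is rational: a rational functional that separates \<open>b\<close> from the row span becomes, after clearing
  denominators, an integer kernel vector that is not orthogonal to \<open>b\<close>.
\<close>

lemma kernel_orthogonal_imp_row_combination:
  fixes A :: "nat^'x::finite^'m::finite"
  assumes "kernel_orthogonal A b"
  obtains \<theta> :: "real^'m" where "\<And>x. real (b x) = (\<Sum>j\<in>UNIV. \<theta> $ j * canonical_statistic A x $ j)"
proof -
  have "(\<exists>r. (\<forall>i\<in>UNIV \<inter> {}. r i \<ge> 0) \<and>
           (\<forall>x. rat_of_nat (b x) = (\<Sum>j\<in>UNIV. r j * rat_of_nat (A $ j $ x)))) \<or>
        (\<exists>u. (\<forall>j\<in>UNIV. dot u (\<lambda>x. rat_of_nat (A $ j $ x)) \<ge> 0) \<and>
           (\<forall>j\<in>UNIV - {}. dot u (\<lambda>x. rat_of_nat (A $ j $ x)) = 0) \<and>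
           dot u (\<lambda>x. rat_of_nat (b x)) < 0)"
    by (rule farkas) simp
  thus ?thesis
  proof (elim disjE exE conjE)
    fix r assume "\<forall>x. rat_of_nat (b x) = (\<Sum>j\<in>UNIV. r j * rat_of_nat (A $ j $ x))"
    hence "real_of_rat (rat_of_nat (b x)) = (\<Sum>j\<in>UNIV. real_of_rat (r j) * real (A $ j $ x))" for x
      by (simp add: of_rat_sum of_rat_mult)
    thus ?thesis
      by (intro that[of "\<chi> j. real_of_rat (r j)"]) (simp add: canonical_statistic_def)
  next
    fix u assume u: "\<forall>j\<in>UNIV - {}. dot u (\<lambda>x. rat_of_nat (A $ j $ x)) = 0"
      "dot u (\<lambda>x. rat_of_nat (b x)) < 0"
    obtain d n where dn: "d > 0" "\<And>x. of_int (n x) = of_int d * u x"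
      using clear_denominators by blast
    have scale: "rat_of_int (\<Sum>x\<in>UNIV. int (f x) * n x) = of_int d * dot u (\<lambda>x. rat_of_nat (f x))"
      for f by (simp add: dot_def dn(2) sum_distrib_left mult_ac)
    have "rat_of_int (\<Sum>x\<in>UNIV. int (A $ j $ x) * n x) = 0" for j
      using u(1) by (subst scale) simp
    hence "n \<in> int_kernel A" by (simp only: of_int_eq_0_iff int_kernel_def mem_Collect_eq simp_thms)
    with assms have "(\<Sum>x\<in>UNIV. int (b x) * n x) = 0" by (auto simp: kernel_orthogonal_def)
    with scale[of b] u(2) dn(1) show ?thesis by simp
  qed
qed

text \<open>
  The two cases exclude each other: a function that vanishes on \<open>S\<close> and is positive off \<open>S\<close> cannot be
  orthogonal to such a \<open>k\<close>. For each single
  \<open>y \<notin> S\<close>, Farkas' lemma applied to the columns of the matrix gives either \<open>k\<close> or a function in the row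
  span that vanishes on \<open>S\<close>, is non-negative off \<open>S\<close> and is positive at \<open>y\<close>. The sum of the latter over
  all \<open>y\<close>, with denominators cleared, is \<open>b\<close>.
\<close>

lemma face_alternative:
  fixes A :: "nat^'x::finite^'m::finite"
  obtains k where "k \<in> int_kernel A" "\<And>x. x \<notin> S \<Longrightarrow> k x \<ge> 0" "\<exists>x. x \<notin> S \<and> k x > 0"
  | b where "kernel_orthogonal A b" "\<And>x. b x = 0 \<longleftrightarrow> x \<in> S"
proof (cases "\<exists>k\<in>int_kernel A. (\<forall>x. x \<notin> S \<longrightarrow> k x \<ge> 0) \<and> (\<exists>x. x \<notin> S \<and> k x > 0)")
  case True
  thus ?thesis using that(1) by blast
next
  case no_kernel_vector: False
  define a where "a x = (\<lambda>j. rat_of_nat (A $ j $ x))" for x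
  have "\<exists>u. (\<forall>x. dot u (a x) \<ge> 0) \<and> (\<forall>x\<in>S. dot u (a x) = 0) \<and> dot u (a y) > 0" if y: "y \<notin> S" for y
  proof -
    have "(\<exists>r. (\<forall>x\<in>UNIV \<inter> - S. r x \<ge> 0) \<and> (\<forall>j. - a y j = (\<Sum>x\<in>UNIV. r x * a x j))) \<or>
        (\<exists>u. (\<forall>x\<in>UNIV. dot u (a x) \<ge> 0) \<and> (\<forall>x\<in>UNIV - - S. dot u (a x) = 0) \<and>
             dot u (\<lambda>j. - a y j) < 0)"
      by (rule farkas) simp
    thus ?thesis
    proof (elim disjE exE conjE)
      fix r assume r: "\<forall>x\<in>UNIV \<inter> - S. r x \<ge> 0" "\<forall>j. - a y j = (\<Sum>x\<in>UNIV. r x * a x j)"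
      (* Moving the target - a y to the other side turns r into a relation between the columns. *)
      define r' where "r' x = r x + (if x = y then 1 else 0)" for x
      obtain d n where dn: "d > 0" "\<And>x. of_int (n x) = of_int d * r' x"
        using clear_denominators by blast
      have "rat_of_int (\<Sum>x\<in>UNIV. int (A $ j $ x) * n x) = 0" for j
      proof -
        have "rat_of_int (\<Sum>x\<in>UNIV. int (A $ j $ x) * n x) = of_int d * (\<Sum>x\<in>UNIV. r' x * a x j)"
          by (simp add: dn(2) sum_distrib_left mult_ac a_def)
        also have "(\<Sum>x\<in>UNIV. r' x * a x j) = (\<Sum>x\<in>UNIV. r x * a x j) + a y j"
          by (simp add: r'_def distrib_right sum.distrib if_distrib[of "\<lambda>z. z * _"] cong: if_cong)
        also have "\<dots> = 0" using r(2)[rule_format, of j] by simp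
        finally show ?thesis by simp
      qed
      hence "n \<in> int_kernel A" by (simp only: of_int_eq_0_iff int_kernel_def mem_Collect_eq simp_thms)
      moreover have "n x \<ge> 0" if "x \<notin> S" for x
      proof -
        have "rat_of_int (n x) \<ge> 0" using that r(1) dn(1) by (simp add: dn(2) r'_def)
        thus ?thesis by simp
      qed
      moreover have "n y > 0"
      proof -
        have "r' y > 0" using r(1) y by (simp add: r'_def add_nonneg_pos)
        hence "rat_of_int (n y) > 0" using dn(1) by (simp add: dn(2))
        thus ?thesis by simp
      qed
      ultimately show ?thesis using no_kernel_vector y by blast
    qed (auto simp: dot_def sum_negf)
  qed
  then obtain u where u: "\<And>y x. y \<notin> S \<Longrightarrow> dot (u y) (a x) \<ge> 0"
    "\<And>y x. y \<notin> S \<Longrightarrow> x \<in> S \<Longrightarrow> dot (u y) (a x) = 0" "\<And>y. y \<notin> S \<Longrightarrow> dot (u y) (a y) > 0"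
    by metis
  define v where "v j = (\<Sum>y\<in>-S. u y j)" for j
  have v: "dot v (a x) = (\<Sum>y\<in>-S. dot (u y) (a x))" for x
    unfolding v_def dot_def by (subst sum.swap) (simp add: sum_distrib_right)
  have v_zero: "dot v (a x) = 0" if "x \<in> S" for x
    using u(2) that by (simp add: v)
  have v_pos: "dot v (a x) > 0" if "x \<notin> S" for x
    unfolding v using that u(1,3) by (intro sum_pos2[of _ x]) auto
  obtain d n where dn: "d > 0" "\<And>j. of_int (n j) = of_int d * v j"
    using clear_denominators by blast
  define f where "f x = (\<Sum>j\<in>UNIV. n j * int (A $ j $ x))" for x
  have f: "rat_of_int (f x) = of_int d * dot v (a x)" for x
    by (simp add: f_def dot_def a_def dn(2) sum_distrib_left mult_ac)
  have f_zero: "f x = 0" if "x \<in> S" for x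
    using f[of x] v_zero[OF that] by simp
  have f_pos: "f x > 0" if "x \<notin> S" for x
  proof -
    have "rat_of_int (f x) > 0" using v_pos[OF that] dn(1) by (simp add: f)
    thus ?thesis by simp
  qed
  have int_f: "int (nat (f x)) = f x" for x using f_zero[of x] f_pos[of x] by (cases "x \<in> S") auto
  show ?thesis
  proof (rule that(2))
    show "kernel_orthogonal A (\<lambda>x. nat (f x))"
      unfolding kernel_orthogonal_def int_f
    proof
      fix k assume k: "k \<in> int_kernel A"
      have "(\<Sum>x\<in>UNIV. f x * k x) = (\<Sum>j\<in>UNIV. n j * (\<Sum>x\<in>UNIV. int (A $ j $ x) * k x))"
        unfolding f_def sum_distrib_left sum_distrib_right mult.assoc by (rule sum.swap)
      also have "\<dots> = 0" using k by (simp add: int_kernel_def)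
      finally show "(\<Sum>x\<in>UNIV. f x * k x) = 0" .
    qed
    show "nat (f x) = 0 \<longleftrightarrow> x \<in> S" for x using f_zero[of x] f_pos[of x] by (cases "x \<in> S") auto
  qed
qed

lemma hilbert_basis_vector:
  assumes "is_hilbert_basis (orthogonal_lattice_vectors A) (b ` {1..l})" "j \<in> {1..l}"
  shows "kernel_orthogonal A (b j)" "b j \<noteq> (\<lambda>x. 0)"
proof -
  have "b j \<in> orthogonal_lattice_vectors A" using assms unfolding is_hilbert_basis_def by blast
  thus "kernel_orthogonal A (b j)" "b j \<noteq> (\<lambda>x. 0)"
    by (simp_all add: orthogonal_lattice_vectors_def kernel_orthogonal_def)
qed

text \<open>
  Injectivity of \<open>b\<close> lets a combination of basis elements be rewritten as a sum over their indices.
\<close>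

lemma hilbert_basis_decomposition:
  fixes A :: "nat^'x::finite^'m" and b :: "nat \<Rightarrow> 'x \<Rightarrow> nat"
  assumes inj: "inj_on b {1..l}"
    and basis: "is_hilbert_basis (orthogonal_lattice_vectors A) (b ` {1..l})"
    and f: "kernel_orthogonal A f"
  obtains n where "\<And>x. f x = (\<Sum>j\<in>{1..l}. n j * b j x)"
proof (cases "f = (\<lambda>x. 0)")
  case True
  thus ?thesis by (intro that[of "\<lambda>_. 0"]) simp
next
  case False
  with f have "f \<in> orthogonal_lattice_vectors A"
    by (simp add: orthogonal_lattice_vectors_def kernel_orthogonal_def)
  with basis have "f \<in> nat_combinations (b ` {1..l})"
    unfolding is_hilbert_basis_def by blast
  then obtain F c where F: "F \<subseteq> b ` {1..l}" "f = (\<lambda>x. \<Sum>g\<in>F. c g * g x)"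
    by (auto simp: nat_combinations_def)
  have "f x = (\<Sum>j\<in>{1..l}. (if b j \<in> F then c (b j) else 0) * b j x)" for x
  proof -
    have "f x = (\<Sum>g\<in>b ` {1..l}. (if g \<in> F then c g else 0) * g x)"
      unfolding F(2) by (rule sum.mono_neutral_cong_left) (use F(1) in auto)
    also have "\<dots> = (\<Sum>j\<in>{1..l}. (if b j \<in> F then c (b j) else 0) * b j x)"
      by (simp only: sum.reindex[OF inj] o_def)
    finally show ?thesis .
  qed
  thus ?thesis by (rule that)
qed

lemma int_kernel_sum_zero:
  assumes "(\<chi> x. 1) \<in> rational_row_span A" "k \<in> int_kernel A"
  shows "(\<Sum>x\<in>UNIV. k x) = 0"
proof -
  have "(\<Sum>x\<in>UNIV. v $ x * rat_of_int (k x)) = 0" if "v \<in> rational_row_span A" for v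
    using that unfolding rational_row_span_def
  proof (induction rule: vec.span_induct)
    case base
    show ?case
      by (auto simp: vec.subspace_def distrib_right sum.distrib mult.assoc simp flip: sum_distrib_left)
  next
    case (step v)
    then obtain j where v: "v = (\<chi> x. rat_of_nat (A $ j $ x))"
      by (auto simp: rows_def row_def)
    have "(\<Sum>x\<in>UNIV. v $ x * rat_of_int (k x)) = rat_of_int (\<Sum>x\<in>UNIV. int (A $ j $ x) * k x)"
      by (simp add: v)
    also have "\<dots> = 0" using assms(2) by (simp add: int_kernel_def)
    finally show ?case .
  qed
  from this[OF assms(1)] have "rat_of_int (\<Sum>x\<in>UNIV. k x) = 0" by simp
  thus ?thesis by (simp only: of_int_eq_0_iff)
qed

section \<open>Equations that hold on the closure of the exponential family\<close>

lemma partition_sum_pos: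
  fixes \<mu> :: "'x::finite \<Rightarrow> real"
  assumes "\<forall>x. \<mu> x > 0"
  shows "(\<Sum>x\<in>UNIV. exp (w x) * \<mu> x) > 0"
  using assms by (intro sum_pos) auto

lemma exp_family_subset_densities:
  assumes "\<forall>x. \<mu> x > 0"
  shows "exp_family \<mu> T \<subseteq> densities \<mu>"
proof -
  have "(\<Sum>x\<in>UNIV. exp (w x - ln (\<Sum>y\<in>UNIV. exp (w y) * \<mu> y)) * \<mu> x) = 1" for w
    using partition_sum_pos[OF assms, of w]
    by (simp add: exp_diff flip: sum_divide_distrib)
  thus ?thesis
    by (auto simp: exp_family_def densities_def log_partition_def)
qed

lemma extended_exp_family_eq:
  assumes "\<forall>x. \<mu> x > 0"
  shows "extended_exp_family \<mu> T = densities \<mu> \<inter> closure (exp_family \<mu> T)"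
  using exp_family_subset_densities[OF assms, of T]
  by (simp add: extended_exp_family_def closure_of_subtopology Int_absorb1)

text \<open>
  The condition on the sum of \<open>k\<close> removes the contribution of the normalizing constant.
\<close>

lemma exp_family_log_orthogonal:
  assumes "p \<in> exp_family \<mu> T"
    and "\<And>j. (\<Sum>x\<in>UNIV. k x * T x $ j) = 0" and "(\<Sum>x\<in>UNIV. k x) = 0"
  shows "(\<Sum>x\<in>UNIV. k x * ln (p x)) = 0"
proof -
  obtain \<theta> where \<theta>: "p = (\<lambda>x. exp ((\<Sum>j\<in>UNIV. \<theta> $ j * T x $ j) - log_partition \<mu> T \<theta>))"
    using assms(1) by (auto simp: exp_family_def)
  have "(\<Sum>x\<in>UNIV. k x * (\<Sum>j\<in>UNIV. \<theta> $ j * T x $ j))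
      = (\<Sum>j\<in>UNIV. \<theta> $ j * (\<Sum>x\<in>UNIV. k x * T x $ j))"
    unfolding sum_distrib_left by (subst sum.swap) (simp add: mult.left_commute)
  thus ?thesis
    using assms(2,3)
    by (simp add: \<theta> right_diff_distrib sum_subtractf flip: sum_distrib_right)
qed

lemma exp_family_pos: "p \<in> exp_family \<mu> T \<Longrightarrow> p x > 0"
  by (auto simp: exp_family_def)

text \<open>
  Exponentiating the linear equation \<open>(\<Sum>x. k x * ln (p x)) = 0\<close> and moving the negative exponents to the
  other side gives a polynomial equation, which makes sense and persists where a limit vanishes.
\<close>

lemma closure_exp_family_binomial:
  fixes A :: "nat^'x::finite^'m::finite"
  assumes row_span: "(\<chi> x. 1) \<in> rational_row_span A"
    and k: "k \<in> int_kernel A" and q: "q \<in> closure (exp_family \<mu> (canonical_statistic A))"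
  shows "(\<Prod>x\<in>UNIV. q x ^ nat (k x)) = (\<Prod>x\<in>UNIV. q x ^ nat (- k x))"
proof -
  let ?V = "{p :: 'x \<Rightarrow> real. (\<Prod>x\<in>UNIV. p x ^ nat (k x)) = (\<Prod>x\<in>UNIV. p x ^ nat (- k x))}"
  have "exp_family \<mu> (canonical_statistic A) \<subseteq> ?V"
  proof
    fix p assume p: "p \<in> exp_family \<mu> (canonical_statistic A)"
    have pw: "(\<Prod>x\<in>UNIV. p x ^ f x) = exp (\<Sum>x\<in>UNIV. real (f x) * ln (p x))" for f
      using exp_family_pos[OF p]
      by (simp add: exp_sum exp_of_nat_mult)
    have "(\<Sum>x\<in>UNIV. real_of_int (k x) * ln (p x)) = 0"
    proof (rule exp_family_log_orthogonal[OF p])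
      fix j
      have "(\<Sum>x\<in>UNIV. real_of_int (k x) * canonical_statistic A x $ j)
          = real_of_int (\<Sum>x\<in>UNIV. int (A $ j $ x) * k x)"
        by (simp add: canonical_statistic_def mult.commute)
      also have "\<dots> = 0" using k by (simp add: int_kernel_def)
      finally show "(\<Sum>x\<in>UNIV. real_of_int (k x) * canonical_statistic A x $ j) = 0" .
    next
      show "(\<Sum>x\<in>UNIV. real_of_int (k x)) = 0"
        using int_kernel_sum_zero[OF row_span k] by (simp flip: of_int_sum)
    qed
    moreover have "real_of_int (k x) = real (nat (k x)) - real (nat (- k x))" for x by simp
    ultimately have "(\<Sum>x\<in>UNIV. real (nat (k x)) * ln (p x))
        = (\<Sum>x\<in>UNIV. real (nat (- k x)) * ln (p x))"
      by (simp only: left_diff_distrib sum_subtractf)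
    thus "p \<in> ?V" by (simp only: mem_Collect_eq pw)
  qed
  moreover have "closed ?V"
    by (intro closed_Collect_eq continuous_on_prod continuous_on_power) auto
  ultimately show ?thesis using q closure_minimal by blast
qed

text \<open>
  For real \<open>k\<close> the linear equation itself survives in the limit as long as \<open>k\<close> is supported where \<open>q\<close> is
  positive, since the logarithm is continuous there.
\<close>

lemma closure_exp_family_log_orthogonal:
  assumes q: "q \<in> closure (exp_family \<mu> T)"
    and supp: "\<And>x. k x \<noteq> 0 \<Longrightarrow> q x > 0"
    and orth: "\<And>j. (\<Sum>x\<in>UNIV. k x * T x $ j) = 0" "(\<Sum>x\<in>UNIV. k x) = 0"
  shows "(\<Sum>x\<in>UNIV. k x * ln (q x)) = 0"
proof -
  obtain p where p: "\<And>n. p n \<in> exp_family \<mu> T" "p \<longlonglongrightarrow> q"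
    using q unfolding closure_sequential by blast
  have "(\<lambda>n. p n x) \<longlonglongrightarrow> q x" for x
    using continuous_on_tendsto_compose[OF continuous_on_product_coordinates p(2)] by simp
  hence "(\<lambda>n. k x * ln (p n x)) \<longlonglongrightarrow> k x * ln (q x)" for x
    using supp[of x] by (cases "k x = 0") (auto intro!: tendsto_intros)
  hence "(\<lambda>n. \<Sum>x\<in>UNIV. k x * ln (p n x)) \<longlonglongrightarrow> (\<Sum>x\<in>UNIV. k x * ln (q x))"
    by (intro tendsto_sum)
  moreover have "(\<Sum>x\<in>UNIV. k x * ln (p n x)) = 0" for n
    using p(1) orth by (rule exp_family_log_orthogonal)
  ultimately show ?thesis by (simp add: LIMSEQ_const_iff)
qed

text \<open>
  Supports of limit densities are exposed: in the binomial equation of a kernel vector \<open>k\<close> that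
  contradicts this, the side with the positive exponents vanishes at \<open>q\<close> and the other side does not.
\<close>

lemma kernel_orthogonal_support:
  fixes A :: "nat^'x::finite^'m::finite"
  assumes row_span: "(\<chi> x. 1) \<in> rational_row_span A"
    and q: "q \<in> closure (exp_family \<mu> (canonical_statistic A))"
    and nonneg: "\<And>x. q x \<ge> 0"
  obtains b where "kernel_orthogonal A b" "\<And>x. b x = 0 \<longleftrightarrow> q x > 0"
proof (cases A "{x. q x > 0}" rule: face_alternative)
  case (1 k)
  then obtain y where y: "\<not> q y > 0" "k y > 0" by blast
  hence "q y = 0" using nonneg[of y] by simp
  have "(\<Prod>x\<in>UNIV. q x ^ nat (k x)) = 0"
    using \<open>q y = 0\<close> y(2) by (intro prod_zero) (auto intro!: bexI[of _ y])
  moreover have "(\<Prod>x\<in>UNIV. q x ^ nat (- k x)) > 0"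
  proof (intro prod_pos ballI)
    show "q x ^ nat (- k x) > 0" for x
      using 1(2)[of x] by (cases "q x > 0") auto
  qed
  ultimately show ?thesis using closure_exp_family_binomial[OF row_span 1(1) q]
    by linarith
qed (auto intro: that)

section \<open>Densities of the monomial model\<close>

lemma model_normalizer_pos:
  fixes \<mu> :: "'x::finite \<Rightarrow> real"
  assumes mu_pos: "\<forall>x. \<mu> x > 0" and "\<forall>j\<in>{1..l}. \<zeta> j \<ge> 0"
    and "model_monomial l b \<zeta> x \<noteq> 0"
  shows "(\<Sum>y\<in>UNIV. model_monomial l b \<zeta> y * \<mu> y) > 0"
proof -
  have nonneg: "model_monomial l b \<zeta> y \<ge> 0" for y
    unfolding model_monomial_def using assms(2) by (intro prod_nonneg) auto
  show ?thesis
    using mu_pos assms(3) nonneg[of x] less_imp_le[of 0 "\<mu> _"]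
    by (intro sum_pos2[of _ x]) (auto intro!: mult_nonneg_nonneg nonneg)
qed

lemma model_density_pos_in_exp_family:
  fixes A :: "nat^'x::finite^'m::finite"
  assumes mu_pos: "\<forall>x. \<mu> x > 0"
    and rows: "\<And>j. j \<in> {1..l} \<Longrightarrow> kernel_orthogonal A (b j)"
    and pos: "\<And>j. j \<in> {1..l} \<Longrightarrow> \<zeta> j > 0"
  shows "model_density \<mu> l b \<zeta> \<in> exp_family \<mu> (canonical_statistic A)"
proof -
  let ?T = "canonical_statistic A"
  have "\<forall>j\<in>{1..l}. \<exists>\<theta>. \<forall>x. real (b j x) = (\<Sum>i\<in>UNIV. \<theta> $ i * ?T x $ i)"
    using rows by (metis kernel_orthogonal_imp_row_combination)
  then obtain \<theta> where \<theta>: "\<And>j x. j \<in> {1..l} \<Longrightarrow> real (b j x) = (\<Sum>i\<in>UNIV. \<theta> j $ i * ?T x $ i)"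
    by metis
  define \<eta> :: "real^'m" where "\<eta> = (\<chi> i. \<Sum>j\<in>{1..l}. ln (\<zeta> j) * \<theta> j $ i)"
  have monomial: "model_monomial l b \<zeta> x = exp (\<Sum>i\<in>UNIV. \<eta> $ i * ?T x $ i)" for x
  proof -
    have "model_monomial l b \<zeta> x = (\<Prod>j\<in>{1..l}. exp (ln (\<zeta> j) * real (b j x)))"
      unfolding model_monomial_def
      by (intro prod.cong refl) (use pos in \<open>simp add: exp_of_nat2_mult\<close>)
    also have "\<dots> = exp (\<Sum>j\<in>{1..l}. ln (\<zeta> j) * (\<Sum>i\<in>UNIV. \<theta> j $ i * ?T x $ i))"
      using \<theta> by (simp add: exp_sum)
    also have "(\<Sum>j\<in>{1..l}. ln (\<zeta> j) * (\<Sum>i\<in>UNIV. \<theta> j $ i * ?T x $ i))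
        = (\<Sum>i\<in>UNIV. \<eta> $ i * ?T x $ i)"
      unfolding \<eta>_def sum_distrib_left by (subst sum.swap) (simp add: sum_distrib_right mult.assoc)
    finally show ?thesis .
  qed
  have "model_density \<mu> l b \<zeta> x = exp ((\<Sum>i\<in>UNIV. \<eta> $ i * ?T x $ i) - log_partition \<mu> ?T \<eta>)" for x
    using partition_sum_pos[OF mu_pos, of "\<lambda>x. \<Sum>i\<in>UNIV. \<eta> $ i * ?T x $ i"]
    by (simp add: model_density_def monomial log_partition_def exp_diff)
  thus ?thesis unfolding exp_family_def by blast
qed

text \<open>
  The curve that adds \<open>\<epsilon>\<close> to all parameters is continuous on \<open>\<epsilon> \<ge> 0\<close>, because the normalizer never
  vanishes there, and lies in the exponential family for \<open>\<epsilon> > 0\<close>.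
\<close>

lemma model_density_in_closure:
  fixes A :: "nat^'x::finite^'m::finite"
  assumes mu_pos: "\<forall>x. \<mu> x > 0"
    and rows: "\<And>j. j \<in> {1..l} \<Longrightarrow> kernel_orthogonal A (b j)"
    and nonneg: "\<forall>j\<in>{1..l}. \<zeta> j \<ge> 0"
    and nonzero: "model_monomial l b \<zeta> x\<^sub>0 \<noteq> 0"
  shows "model_density \<mu> l b \<zeta> \<in> closure (exp_family \<mu> (canonical_statistic A))"
proof -
  define f where "f \<epsilon> = model_density \<mu> l b (\<lambda>j. \<zeta> j + \<epsilon>)" for \<epsilon>
  have denom: "(\<Sum>y\<in>UNIV. model_monomial l b (\<lambda>j. \<zeta> j + \<epsilon>) y * \<mu> y) \<noteq> 0" if "\<epsilon> \<ge> 0" for \<epsilon>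
  proof -
    have nn: "\<forall>j\<in>{1..l}. \<zeta> j + \<epsilon> \<ge> 0" using nonneg that by auto
    have "model_monomial l b (\<lambda>j. \<zeta> j + \<epsilon>) x\<^sub>0 \<noteq> 0"
    proof (cases "\<epsilon> = 0")
      case False
      hence "\<forall>j\<in>{1..l}. \<zeta> j + \<epsilon> > 0" using nonneg that by (simp add: add_nonneg_pos)
      thus ?thesis by (force simp: model_monomial_def)
    qed (use nonzero in simp)
    from model_normalizer_pos[OF mu_pos nn this] show ?thesis by simp
  qed
  have "f ` closure {0<..} \<subseteq> closure (exp_family \<mu> (canonical_statistic A))"
  proof (rule image_closure_subset)
    show "continuous_on (closure {0<..}) f"
      unfolding f_def model_density_def
      using denom
      by (intro continuous_on_coordinatewise_then_product continuous_intros)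
         (auto simp: model_monomial_def intro!: continuous_intros)
    show "f ` {0<..} \<subseteq> closure (exp_family \<mu> (canonical_statistic A))"
    proof safe
      fix \<epsilon> :: real assume "\<epsilon> > 0"
      hence "f \<epsilon> \<in> exp_family \<mu> (canonical_statistic A)"
        unfolding f_def using nonneg
        by (intro model_density_pos_in_exp_family[OF mu_pos rows]) (auto intro: add_nonneg_pos)
      thus "f \<epsilon> \<in> closure (exp_family \<mu> (canonical_statistic A))"
        using closure_subset by blast
    qed
  qed simp
  moreover have "f 0 = model_density \<mu> l b \<zeta>" by (simp add: f_def)
  ultimately show ?thesis by (force simp: image_subset_iff)
qed

text \<open>
  On the support \<open>S\<close> of \<open>q\<close>, the function \<open>ln q\<close> is a combination of the \<open>b j\<close> by duality: a vector \<open>k\<close>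
  supported on \<open>S\<close> and orthogonal to all \<open>b j\<close> is orthogonal to the rows of \<open>A\<close> and to \<open>1\<close>, hence to
  \<open>ln q\<close>. The zeros of \<open>q\<close> are produced by the parameters of those \<open>b j\<close> that occur in a vector with
  zero set \<open>S\<close>; as these \<open>b j\<close> vanish on \<open>S\<close>, their parameters are not used there. The monomials equal
  \<open>q\<close> without normalization because the constant \<open>1\<close> is itself in the span of the \<open>b j\<close>.
\<close>

lemma closure_imp_model_density:
  fixes A :: "nat^'x::finite^'m::finite" and b :: "nat \<Rightarrow> 'x \<Rightarrow> nat"
  assumes row_span: "(\<chi> x. 1) \<in> rational_row_span A"
    and inj: "inj_on b {1..l}"
    and basis: "is_hilbert_basis (orthogonal_lattice_vectors A) (b ` {1..l})"
    and q: "q \<in> closure (exp_family \<mu> (canonical_statistic A))"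
    and nonneg: "\<And>x. q x \<ge> 0"
  obtains \<zeta> :: "nat \<Rightarrow> real" where "\<forall>j\<in>{1..l}. \<zeta> j \<ge> 0" "\<And>x. model_monomial l b \<zeta> x = q x"
proof -
  define S where "S = {x. q x > 0}"
  obtain c where c: "\<And>x. x \<in> S \<Longrightarrow> ln (q x) = (\<Sum>j\<in>{1..l}. c j * real (b j x))"
  proof -
    (* Extension by zero off S: Farkas' lemma then only sees the restrictions to S. *)
    define g where "g j x = (if x \<in> S then real (b j x) else 0)" for j x
    define h where "h x = (if x \<in> S then ln (q x) else 0)" for x
    have "(\<exists>r. (\<forall>j\<in>{1..l} \<inter> {}. r j \<ge> 0) \<and> (\<forall>x. h x = (\<Sum>j\<in>{1..l}. r j * g j x))) \<or>
          (\<exists>u. (\<forall>j\<in>{1..l}. dot u (g j) \<ge> 0) \<and> (\<forall>j\<in>{1..l} - {}. dot u (g j) = 0) \<and> dot u h < 0)"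
      by (rule farkas) simp
    thus ?thesis
    proof (elim disjE exE conjE)
      fix r assume "\<forall>x. h x = (\<Sum>j\<in>{1..l}. r j * g j x)"
      thus ?thesis by (intro that[of r]) (simp add: h_def g_def split: if_splits)
    next
      fix u assume u: "\<forall>j\<in>{1..l} - {}. dot u (g j) = 0" "dot u h < 0"
      define k where "k x = (if x \<in> S then u x else 0)" for x
      have k_basis: "(\<Sum>x\<in>UNIV. k x * real (b j x)) = 0" if "j \<in> {1..l}" for j
      proof -
        have "(\<Sum>x\<in>UNIV. k x * real (b j x)) = dot u (g j)"
          unfolding dot_def by (intro sum.cong) (auto simp: k_def g_def)
        thus ?thesis using u(1) that by simp
      qed
      have k_orth: "(\<Sum>x\<in>UNIV. k x * real (f x)) = 0" if f: "kernel_orthogonal A f" for f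
      proof -
        obtain n where "\<And>x. f x = (\<Sum>j\<in>{1..l}. n j * b j x)"
          using hilbert_basis_decomposition[OF inj basis f] by blast
        hence "(\<Sum>x\<in>UNIV. k x * real (f x))
            = (\<Sum>x\<in>UNIV. \<Sum>j\<in>{1..l}. real (n j) * (k x * real (b j x)))"
          by (simp add: sum_distrib_left mult.left_commute)
        also have "\<dots> = (\<Sum>j\<in>{1..l}. real (n j) * (\<Sum>x\<in>UNIV. k x * real (b j x)))"
          unfolding sum_distrib_left by (rule sum.swap)
        also have "\<dots> = 0" using k_basis by simp
        finally show ?thesis .
      qed
      have "(\<Sum>x\<in>UNIV. k x * ln (q x)) = 0"
      proof (rule closure_exp_family_log_orthogonal[OF q])
        show "q x > 0" if "k x \<noteq> 0" for x
          using that by (simp add: k_def S_def split: if_splits)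
        show "(\<Sum>x\<in>UNIV. k x * canonical_statistic A x $ j) = 0" for j
          using k_orth[of "\<lambda>x. A $ j $ x"]
          by (simp add: canonical_statistic_def kernel_orthogonal_def int_kernel_def)
        show "(\<Sum>x\<in>UNIV. k x) = 0"
          using k_orth[of "\<lambda>x. 1"] int_kernel_sum_zero[OF row_span]
          by (simp add: kernel_orthogonal_def)
      qed
      moreover have "(\<Sum>x\<in>UNIV. k x * ln (q x)) = dot u h"
        unfolding dot_def by (intro sum.cong) (auto simp: k_def h_def)
      ultimately show ?thesis using u(2) by simp
    qed
  qed
  obtain f where f: "kernel_orthogonal A f" "\<And>x. f x = 0 \<longleftrightarrow> q x > 0"
    using kernel_orthogonal_support[OF row_span q nonneg] by blast
  obtain n where n: "\<And>x. f x = (\<Sum>j\<in>{1..l}. n j * b j x)"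
    using hilbert_basis_decomposition[OF inj basis f(1)] by blast
  define \<zeta> where "\<zeta> j = (if n j = 0 then exp (c j) else 0)" for j
  have vanish: "b j x = 0" if "x \<in> S" "j \<in> {1..l}" "n j \<noteq> 0" for j x
  proof -
    have "(\<Sum>j\<in>{1..l}. n j * b j x) = 0" using that(1) f(2)[of x] n[of x] by (simp add: S_def)
    hence "n j * b j x = 0" using that(2) by (subst (asm) sum_eq_0_iff) auto
    with that(3) show ?thesis by simp
  qed
  show ?thesis
  proof (rule that)
    show \<zeta>_nonneg: "\<forall>j\<in>{1..l}. \<zeta> j \<ge> 0" by (simp add: \<zeta>_def)
    show "model_monomial l b \<zeta> x = q x" for x
    proof (cases "x \<in> S")
      case True
      have "model_monomial l b \<zeta> x = (\<Prod>j\<in>{1..l}. exp (c j * real (b j x)))"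
        unfolding model_monomial_def
        by (intro prod.cong refl) (use vanish[OF True] in \<open>auto simp: \<zeta>_def exp_of_nat2_mult\<close>)
      also have "\<dots> = exp (ln (q x))" by (simp add: c[OF True] exp_sum)
      also have "\<dots> = q x" using True by (simp add: S_def)
      finally show ?thesis .
    next
      case False
      hence "f x \<noteq> 0" "q x = 0" using f(2)[of x] nonneg[of x] by (auto simp: S_def)
      obtain j where "j \<in> {1..l}" "n j * b j x \<noteq> 0"
        using \<open>f x \<noteq> 0\<close> unfolding n by (rule sum.not_neutral_contains_not_neutral)
      hence "model_monomial l b \<zeta> x = 0" by (force simp: model_monomial_def \<zeta>_def)
      with \<open>q x = 0\<close> show ?thesis by simp
    qed
  qed
qed

section \<open>Exposed subsets\<close>

lemma exposed_subset_zeros: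
  fixes A :: "nat^'x::finite^'m::finite"
  assumes "kernel_orthogonal A b"
  shows "exposed_subset (canonical_statistic A) {x. b x = 0}"
proof -
  let ?T = "canonical_statistic A"
  obtain \<theta> :: "real^'m" where "\<And>x. real (b x) = (\<Sum>j\<in>UNIV. \<theta> $ j * ?T x $ j)"
    using kernel_orthogonal_imp_row_combination[OF assms] by blast
  hence \<theta>: "\<theta> \<bullet> ?T x = real (b x)" for x by (simp add: inner_vec_def)
  let ?F = "{y \<in> marginal_polytope ?T. \<theta> \<bullet> y = 0}"
  have "marginal_polytope ?T \<subseteq> {y. \<theta> \<bullet> y \<ge> 0}"
    unfolding marginal_polytope_def
    by (rule hull_minimal) (auto simp: \<theta> convex_halfspace_ge)
  moreover have "linear (\<lambda>y. \<theta> \<bullet> y)" by (intro bounded_linear.linear bounded_linear_inner_right)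
  ultimately have "marginal_face (marginal_polytope ?T) ?F"
    unfolding marginal_face_def by (intro conjI exI[of _ "\<lambda>y. \<theta> \<bullet> y"] exI[of _ 0]) force+
  moreover have "?T x \<in> marginal_polytope ?T" for x
    unfolding marginal_polytope_def by (intro hull_inc) simp
  hence "{x. b x = 0} = ?T -` ?F" by (auto simp: \<theta>)
  ultimately show ?thesis unfolding exposed_subset_def by blast
qed

text \<open>
  The affine function that cuts out the face has real coefficients, but it excludes the kernel vector
  of \<open>face_alternative\<close>: composed with the statistics it is orthogonal to the integer kernel, the
  additive constant being absorbed by the constant vector in the row span. The other alternative then
  provides an integer vector with the same zero set.
\<close>

lemma exposed_subset_imp_zeros:
  fixes A :: "nat^'x::finite^'m::finite"
  assumes row_span: "(\<chi> x. 1) \<in> rational_row_span A"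
    and "exposed_subset (canonical_statistic A) S"
  obtains b where "kernel_orthogonal A b" "S = {x. b x = 0}"
proof -
  let ?T = "canonical_statistic A"
  obtain F and g :: "real^'m \<Rightarrow> real" and c where F: "S = ?T -` F" and "linear g"
    and zero: "\<forall>y\<in>F. g y + c = 0" and pos: "\<forall>y\<in>marginal_polytope ?T - F. g y + c > 0"
    using assms(2) unfolding exposed_subset_def marginal_face_def by blast
  define v where "v x = g (?T x) + c" for x
  have v_zero: "v x = 0" if "x \<in> S" for x using that F zero by (auto simp: v_def)
  have "?T x \<in> marginal_polytope ?T" for x
    unfolding marginal_polytope_def by (intro hull_inc) simp
  hence v_pos: "v x > 0" if "x \<notin> S" for x using that F pos by (auto simp: v_def)
  have v_orth: "(\<Sum>x\<in>UNIV. real_of_int (k x) * v x) = 0" if k: "k \<in> int_kernel A" for k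
  proof -
    have "(\<Sum>x\<in>UNIV. real_of_int (k x) *\<^sub>R ?T x) = 0"
    proof (rule vec_eq_iff[THEN iffD2], rule allI)
      fix j
      have "(\<Sum>x\<in>UNIV. real_of_int (k x) *\<^sub>R ?T x) $ j
          = real_of_int (\<Sum>x\<in>UNIV. int (A $ j $ x) * k x)"
        by (simp add: canonical_statistic_def mult.commute)
      also have "\<dots> = 0" using k by (simp add: int_kernel_def)
      finally show "(\<Sum>x\<in>UNIV. real_of_int (k x) *\<^sub>R ?T x) $ j = (0 :: real^'m) $ j" by simp
    qed
    hence "(\<Sum>x\<in>UNIV. real_of_int (k x) * g (?T x)) = 0"
      using linear_sum[OF \<open>linear g\<close>, of "\<lambda>x. real_of_int (k x) *\<^sub>R ?T x" UNIV]
        linear_0[OF \<open>linear g\<close>] by (simp add: linear_scale[OF \<open>linear g\<close>])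
    moreover have "(\<Sum>x\<in>UNIV. real_of_int (k x)) = 0"
      using int_kernel_sum_zero[OF row_span k] by (simp flip: of_int_sum)
    ultimately show ?thesis
      by (simp add: v_def distrib_left sum.distrib flip: sum_distrib_right)
  qed
  show ?thesis
  proof (cases A S rule: face_alternative)
    case (1 k)
    then obtain y where y: "y \<notin> S" "k y > 0" by blast
    have "real_of_int (k x) * v x \<ge> 0" for x
      using 1(2)[of x] v_zero[of x] v_pos[of x] by (cases "x \<in> S") auto
    moreover have "real_of_int (k y) * v y > 0" using y v_pos by simp
    ultimately have "(\<Sum>x\<in>UNIV. real_of_int (k x) * v x) > 0"
      by (intro sum_pos2[of _ y]) auto
    with v_orth[OF 1(1)] show ?thesis by simp
  qed (auto intro: that)
qed

text \<open>
  Any basis element that occurs in a vector with zero set \<open>S\<close> vanishes on \<open>S\<close>, and its own zero set is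
  exposed and different from the whole space, so maximality leaves no room between the two sets.
\<close>

lemma maximal_exposed_subset_basis_zeros:
  fixes A :: "nat^'x::finite^'m::finite" and b :: "nat \<Rightarrow> 'x \<Rightarrow> nat"
  assumes row_span: "(\<chi> x. 1) \<in> rational_row_span A"
    and inj: "inj_on b {1..l}"
    and basis: "is_hilbert_basis (orthogonal_lattice_vectors A) (b ` {1..l})"
    and S: "maximal_exposed_subset (canonical_statistic A) S"
  obtains j where "j \<in> {1..l}" "S = {x. b j x = 0}"
proof -
  have exposed: "exposed_subset (canonical_statistic A) S" and S_proper: "S \<noteq> {}" "S \<noteq> UNIV"
    and maximal: "\<And>S'. exposed_subset (canonical_statistic A) S' \<Longrightarrow> S' \<noteq> {} \<Longrightarrow> S' \<noteq> UNIV \<Longrightarrow>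
      S \<subseteq> S' \<Longrightarrow> S' = S"
    using S unfolding maximal_exposed_subset_def by blast+
  obtain f where f: "kernel_orthogonal A f" "S = {x. f x = 0}"
    using exposed_subset_imp_zeros[OF row_span exposed] by blast
  obtain n where n: "\<And>x. f x = (\<Sum>j\<in>{1..l}. n j * b j x)"
    using hilbert_basis_decomposition[OF inj basis f(1)] by blast
  obtain y where "f y \<noteq> 0" using S_proper(2) f(2) by blast
  then obtain j where j: "j \<in> {1..l}" "n j * b j y \<noteq> 0"
    unfolding n by (rule sum.not_neutral_contains_not_neutral)
  have sub: "S \<subseteq> {x. b j x = 0}"
  proof
    fix x assume "x \<in> S"
    hence "(\<Sum>j\<in>{1..l}. n j * b j x) = 0" using n[of x] f(2) by simp
    hence "n j * b j x = 0" using j(1) by (subst (asm) sum_eq_0_iff) auto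
    with j(2) show "x \<in> {x. b j x = 0}" by simp
  qed
  have "{x. b j x = 0} = S"
  proof (rule maximal)
    show "exposed_subset (canonical_statistic A) {x. b j x = 0}"
      by (intro exposed_subset_zeros hilbert_basis_vector[OF basis j(1)])
    show "{x. b j x = 0} \<noteq> {}" using sub S_proper(1) by blast
    show "{x. b j x = 0} \<noteq> UNIV" using hilbert_basis_vector(2)[OF basis j(1)] by auto
  qed (rule sub)
  with j(1) show ?thesis using that by blast
qed

lemma model_density_support:
  fixes \<mu> :: "'x::finite \<Rightarrow> real"
  assumes mu_pos: "\<forall>x. \<mu> x > 0" and j: "j \<in> {1..l}" and ex: "\<exists>x. b j x = 0"
    and \<zeta>: "\<zeta> j = 0" "\<forall>i\<in>{1..l} - {j}. \<zeta> i > 0"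
  shows "{x. model_density \<mu> l b \<zeta> x \<noteq> 0} = {x. b j x = 0}"
proof -
  have nonzero: "model_monomial l b \<zeta> x \<noteq> 0 \<longleftrightarrow> b j x = 0" for x
    using j \<zeta> by (force simp: model_monomial_def)
  have "\<forall>i\<in>{1..l}. \<zeta> i \<ge> 0"
  proof
    show "\<zeta> i \<ge> 0" if "i \<in> {1..l}" for i
      using \<zeta> that by (cases "i = j") (auto intro: less_imp_le)
  qed
  hence "(\<Sum>y\<in>UNIV. model_monomial l b \<zeta> y * \<mu> y) > 0"
    using ex nonzero model_normalizer_pos[OF mu_pos] by blast
  thus ?thesis using nonzero by (auto simp: model_density_def)
qed

section \<open>The parametrization theorem\<close>

theorem theorem3:
  fixes \<mu> :: "'x::finite \<Rightarrow> real"
    and A :: "nat^'x^'m::finite"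
    and l :: nat
    and b :: "nat \<Rightarrow> 'x \<Rightarrow> nat"
  assumes mu_pos: "\<forall>x. \<mu> x > 0"
    and row_span: "(\<chi> x. 1) \<in> rational_row_span A"
    and b_inj: "inj_on b {1..l}"
    and b_basis: "is_hilbert_basis (orthogonal_lattice_vectors A) (b ` {1..l})"
  shows "(\<forall>q\<in>densities \<mu>.
            q \<in> extended_exp_family \<mu> (canonical_statistic A) \<longleftrightarrow>
            (\<exists>\<zeta> :: nat \<Rightarrow> real.
               (\<forall>j\<in>{1..l}. \<zeta> j \<ge> 0) \<and>
               \<not> (\<forall>x. model_monomial l b \<zeta> x = 0) \<and>
               (\<forall>x. q x = model_density \<mu> l b \<zeta> x)))
       \<and> (\<forall>S. maximal_exposed_subset (canonical_statistic A) S \<longrightarrow>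
            (\<exists>j\<in>{1..l}. S = {x. b j x = 0} \<and>
               (\<forall>\<zeta> :: nat \<Rightarrow> real. \<zeta> j = 0 \<and> (\<forall>i\<in>{1..l} - {j}. \<zeta> i > 0) \<longrightarrow>
                  S = {x. model_density \<mu> l b \<zeta> x \<noteq> 0})))"
proof (intro conjI ballI allI impI)
  let ?E = "exp_family \<mu> (canonical_statistic A)"
  fix q assume q: "q \<in> densities \<mu>"
  hence q_nonneg: "\<And>x. q x \<ge> 0" and q_sum: "(\<Sum>x\<in>UNIV. q x * \<mu> x) = 1"
    by (auto simp: densities_def)
  have "q \<in> closure ?E \<longleftrightarrow>
      (\<exists>\<zeta> :: nat \<Rightarrow> real. (\<forall>j\<in>{1..l}. \<zeta> j \<ge> 0) \<and> \<not> (\<forall>x. model_monomial l b \<zeta> x = 0) \<and>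
         (\<forall>x. q x = model_density \<mu> l b \<zeta> x))"
  proof
    assume q': "q \<in> closure ?E"
    obtain \<zeta> :: "nat \<Rightarrow> real" where \<zeta>: "\<forall>j\<in>{1..l}. \<zeta> j \<ge> 0" "\<And>x. model_monomial l b \<zeta> x = q x"
      using closure_imp_model_density[OF row_span b_inj b_basis q' q_nonneg] by blast
    have "\<not> (\<forall>x. q x = 0)"
    proof
      assume "\<forall>x. q x = 0"
      hence "(\<Sum>x\<in>UNIV. q x * \<mu> x) = 0" by simp
      with q_sum show False by simp
    qed
    with \<zeta> q_sum show "\<exists>\<zeta> :: nat \<Rightarrow> real. (\<forall>j\<in>{1..l}. \<zeta> j \<ge> 0) \<and> \<not> (\<forall>x. model_monomial l b \<zeta> x = 0) \<and>
         (\<forall>x. q x = model_density \<mu> l b \<zeta> x)"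
      by (intro exI[of _ \<zeta>]) (simp add: model_density_def)
  next
    assume "\<exists>\<zeta> :: nat \<Rightarrow> real. (\<forall>j\<in>{1..l}. \<zeta> j \<ge> 0) \<and> \<not> (\<forall>x. model_monomial l b \<zeta> x = 0) \<and>
         (\<forall>x. q x = model_density \<mu> l b \<zeta> x)"
    then obtain \<zeta> x\<^sub>0 where \<zeta>: "\<forall>j\<in>{1..l}. \<zeta> j \<ge> (0::real)" "model_monomial l b \<zeta> x\<^sub>0 \<noteq> 0"
      "q = model_density \<mu> l b \<zeta>" by (auto simp: fun_eq_iff)
    show "q \<in> closure ?E"
      unfolding \<zeta>(3) using mu_pos hilbert_basis_vector(1)[OF b_basis] \<zeta>(1,2)
      by (rule model_density_in_closure)
  qed
  thus "q \<in> extended_exp_family \<mu> (canonical_statistic A) \<longleftrightarrow>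
      (\<exists>\<zeta> :: nat \<Rightarrow> real. (\<forall>j\<in>{1..l}. \<zeta> j \<ge> 0) \<and> \<not> (\<forall>x. model_monomial l b \<zeta> x = 0) \<and>
         (\<forall>x. q x = model_density \<mu> l b \<zeta> x))"
    using q by (simp add: extended_exp_family_eq[OF mu_pos])
next
  fix S assume S: "maximal_exposed_subset (canonical_statistic A) S"
  obtain j where j: "j \<in> {1..l}" "S = {x. b j x = 0}"
    using maximal_exposed_subset_basis_zeros[OF row_span b_inj b_basis S] by blast
  have "\<exists>x. b j x = 0" using S j(2) by (auto simp: maximal_exposed_subset_def)
  with j show "\<exists>j\<in>{1..l}. S = {x. b j x = 0} \<and>
      (\<forall>\<zeta> :: nat \<Rightarrow> real. \<zeta> j = 0 \<and> (\<forall>i\<in>{1..l} - {j}. \<zeta> i > 0) \<longrightarrow>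
         S = {x. model_density \<mu> l b \<zeta> x \<noteq> 0})"
    using model_density_support[OF mu_pos] by (intro bexI[of _ j]) auto
qed

end
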